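(* Let $S$ be a set, $d\in\mathbb{N}$, $S^{\le d}=\{a\in\mathcal{F}(S):\ |a|\le d\}$, and let $G$ be a commutative semigroup. For any mapping $\varphi:S^{\le d}\to G$, the mapping $P:\mathcal{F}(S)\to G$ defined by $$P(n)=\sum_{a\subseteq n,\ |a|\le d}\varphi(a)$$ is a polynomial mapping of degree $\le d$; and every polynomial mapping $\mathcal{F}(S)\to G$ of degree $\le d$ is of this form for a suitable mapping $\varphi:S^{\le d}\to G$.
   Context: For a set $W$, $\mathcal{F}(W)$ is the set of finite subsets of $W$ (including $\emptyset$). Polynomial mappings from $\mathcal{F}(W)$ (for any set $W$) into a commutative semigroup $G$ are defined recursively: a mapping is polynomial of degree $0$ if it is constant; for $d\in\mathbb{N}$, $P:\mathcal{F}(W)\to G$ is polynomial of degree $\le d$ if for every $m\in\mathcal{F}(W)$ there exists a polynomial mapping $D_mP:\mathcal{F}(W\setminus m)\to G$ of degree $\le d-1$ such that $P(n\cup m)=P(n)+(D_mP)(n)$ for every $n\in\mathcal{F}(W)$ with $n\cap m=\emptyset$.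
   Formalization: In the definition of polynomial mappings the condition on D_mP is required only for nonempty m: for m = ∅ it would read P(n) = P(n) + (D_mP)(n), which is impossible in a semigroup such as the positive integers; if G has a zero the two definitions agree. *)

theory Defs
  imports Main
begin

(* Sum of f over a nonempty finite set A in a commutative semigroup, which need not have
   a zero: the fold starts from the value at some element of A instead of from 0.  The
   result does not depend on that element (sum1_eq), and it is the usual sum as soon as
   there is a zero (sum1_eq_sum). *)
definition sum1 :: "('b \<Rightarrow> 'g::ab_semigroup_add) \<Rightarrow> 'b set \<Rightarrow> 'g" where
  "sum1 f A = (let x = (SOME x. x \<in> A) in Finite_Set.fold (\<lambda>y s. f y + s) (f x) (A - {x}))"

(* For a set S this is the domain S^{<= d} of the coefficient maps. *)
definition Fpow_le :: "'a set \<Rightarrow> nat \<Rightarrow> 'a set set" where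
  "Fpow_le S d = {a \<in> Fpow S. card a \<le> d}"

(* polynomial_le d W P: the restriction of P to Fpow W is polynomial of degree <= d.
   Only the values of P on Fpow W matter.

   The clause is imposed for nonempty m.  For m = {} it would read P n = P n + D n, which no
   map into, say, the positive integers satisfies.  If the semigroup has a zero, D = 0 serves
   for m = {}, so that the clause for all m gives the same notion
   (polynomial_le_Suc_monoid). *)
primrec polynomial_le :: "nat \<Rightarrow> 'a set \<Rightarrow> ('a set \<Rightarrow> 'g::ab_semigroup_add) \<Rightarrow> bool" where
  "polynomial_le 0 W P \<longleftrightarrow> (\<exists>c. \<forall>n\<in>Fpow W. P n = c)"
| "polynomial_le (Suc d) W P \<longleftrightarrow>
     (\<forall>m\<in>Fpow W. m \<noteq> {} \<longrightarrow>
        (\<exists>D. polynomial_le d (W - m) D \<and>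
             (\<forall>n\<in>Fpow W. n \<inter> m = {} \<longrightarrow> P (n \<union> m) = P n + D n)))"

lemma comp_fun_commute_add: "comp_fun_commute (\<lambda>y s. f y + (s::'g::ab_semigroup_add))"
  by unfold_locales (auto simp: fun_eq_iff ac_simps)

lemma sum1_eq:
  fixes f :: "'b \<Rightarrow> 'g::ab_semigroup_add"
  assumes "finite A" "a \<in> A"
  shows "sum1 f A = Finite_Set.fold (\<lambda>y s. f y + s) (f a) (A - {a})"
proof -
  interpret comp_fun_commute "\<lambda>y s. f y + (s::'g)"
    by (rule comp_fun_commute_add)
  define b where "b = (SOME x. x \<in> A)"
  have b: "b \<in> A"
    unfolding b_def using assms(2) by (rule someI)
  have swap: "Finite_Set.fold (\<lambda>y s. f y + s) (f x) (A - {x}) =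
      Finite_Set.fold (\<lambda>y s. f y + s) (f y + f x) (A - {x, y})"
    if "x \<in> A" "y \<in> A" "x \<noteq> y" for x y
  proof -
    have "A - {x} = insert y (A - {x, y})"
      using that by auto
    then show ?thesis
      using assms(1) by (simp add: fold_fun_left_comm)
  qed
  have "Finite_Set.fold (\<lambda>y s. f y + s) (f b) (A - {b}) =
      Finite_Set.fold (\<lambda>y s. f y + s) (f a) (A - {a})"
    using swap[of a b] swap[of b a] assms(2) b
    by (cases "a = b") (auto simp: insert_commute add.commute)
  then show ?thesis
    by (simp add: sum1_def b_def Let_def)
qed

lemma sum1_singleton: "sum1 f {x} = f x"
  by (simp add: sum1_eq[of "{x}" x])

lemma sum1_insert:
  fixes f :: "'b \<Rightarrow> 'g::ab_semigroup_add"
  assumes "finite A" "A \<noteq> {}" "x \<notin> A"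
  shows "sum1 f (insert x A) = f x + sum1 f A"
proof -
  interpret comp_fun_commute "\<lambda>y s. f y + (s::'g)"
    by (rule comp_fun_commute_add)
  obtain a where a: "a \<in> A"
    using assms(2) by auto
  have "insert x A - {a} = insert x (A - {a})"
    using a assms(3) by auto
  then show ?thesis
    using a assms sum1_eq[of A a f] sum1_eq[of "insert x A" a f] by simp
qed

lemma sum1_eq_sum:
  fixes f :: "'b \<Rightarrow> 'g::comm_monoid_add"
  assumes "finite A" "A \<noteq> {}"
  shows "sum1 f A = sum f A"
  using assms by (induction A rule: finite_ne_induct) (simp_all add: sum1_singleton sum1_insert)

lemma polynomial_le_zero: "polynomial_le d W (\<lambda>n. 0::'g::comm_monoid_add)"
  by (induction d arbitrary: W) (auto intro!: exI[of _ "\<lambda>n. 0"])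

lemma polynomial_le_Suc_monoid:
  fixes P :: "'a set \<Rightarrow> 'g::comm_monoid_add"
  shows "polynomial_le (Suc d) W P \<longleftrightarrow>
     (\<forall>m\<in>Fpow W.
        (\<exists>D. polynomial_le d (W - m) D \<and>
             (\<forall>n\<in>Fpow W. n \<inter> m = {} \<longrightarrow> P (n \<union> m) = P n + D n)))"
proof -
  have "\<exists>D. polynomial_le d (W - {}) D \<and>
      (\<forall>n\<in>Fpow W. n \<inter> {} = {} \<longrightarrow> P (n \<union> {}) = P n + D n)"
    by (rule exI[of _ "\<lambda>n. 0"]) (simp add: polynomial_le_zero)
  then show ?thesis
    unfolding polynomial_le.simps by metis
qed

end

theory Submission
  imports Defs
begin

(* The direct part: the subsets a of n Un m of size <= d + 1 that meet m are grouped by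
   b = a - m, which exhibits the difference as a sum over the b <= n of size <= d.

   The converse: since G need not be cancellative, the coefficients of P cannot be computed
   by inclusion-exclusion, and the differences D_x P are not determined by P.  Instead, fix a
   linear order on S and, inductively, coefficients psi x of one D_{x} P for every x.  Building
   n up in increasing order gives P(n) = P({}) + sum over x in n of (D_{x} P)({y in n. y < x}),
   so phi a = psi (max a) (a - {max a}) works. *)

section \<open>Calculus of nonempty finite sums in a semigroup without zero\<close>

lemma sum1_cong:
  fixes f g :: "'b \<Rightarrow> 'g::ab_semigroup_add"
  assumes "finite A" "A \<noteq> {}" "\<And>x. x \<in> A \<Longrightarrow> f x = g x"
  shows "sum1 f A = sum1 g A"
  using assms by (induction A rule: finite_ne_induct) (simp_all add: sum1_singleton sum1_insert)

lemma sum1_Un_disjoint: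
  fixes f :: "'b \<Rightarrow> 'g::ab_semigroup_add"
  assumes "finite A" "A \<noteq> {}" "finite B" "B \<noteq> {}" "A \<inter> B = {}"
  shows "sum1 f (A \<union> B) = sum1 f A + sum1 f B"
  using assms
  by (induction A rule: finite_ne_induct) (simp_all add: sum1_singleton sum1_insert add.assoc)

lemma sum1_reindex:
  fixes f :: "'b \<Rightarrow> 'g::ab_semigroup_add"
  assumes "finite A" "A \<noteq> {}" "inj_on h A"
  shows "sum1 f (h ` A) = sum1 (\<lambda>x. f (h x)) A"
  using assms
  by (induction A rule: finite_ne_induct) (simp_all add: sum1_singleton sum1_insert)

text \<open>Summation by blocks. Nonemptiness is asked of every block because an empty one would
  contribute an arbitrary value of \<open>f\<close>, there being no zero.\<close>

lemma sum1_UN_disjoint: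
  fixes f :: "'b \<Rightarrow> 'g::ab_semigroup_add"
  assumes "finite I" "I \<noteq> {}"
    and "\<And>i. i \<in> I \<Longrightarrow> finite (A i)" "\<And>i. i \<in> I \<Longrightarrow> A i \<noteq> {}"
    and "\<And>i j. i \<in> I \<Longrightarrow> j \<in> I \<Longrightarrow> i \<noteq> j \<Longrightarrow> A i \<inter> A j = {}"
  shows "sum1 f (\<Union>i\<in>I. A i) = sum1 (\<lambda>i. sum1 f (A i)) I"
  using assms
proof (induction I rule: finite_ne_induct)
  case (singleton i)
  then show ?case by (simp add: sum1_singleton)
next
  case (insert i I)
  have "sum1 f (A i \<union> (\<Union>j\<in>I. A j)) = sum1 f (A i) + sum1 f (\<Union>j\<in>I. A j)"
  proof (rule sum1_Un_disjoint)
    show "A i \<inter> (\<Union>j\<in>I. A j) = {}"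
      using insert.hyps(3) insert.prems(3)[of i] by auto
  qed (use insert in auto)
  also have "sum1 f (\<Union>j\<in>I. A j) = sum1 (\<lambda>j. sum1 f (A j)) I"
    using insert.prems by (intro insert.IH) auto
  finally show ?case
    using insert.hyps by (simp add: sum1_insert)
qed

section \<open>Bounded-size subsets of a disjoint union\<close>

lemma finite_Fpow_le [simp]: "finite n \<Longrightarrow> finite (Fpow_le n d)"
  by (rule finite_subset[of _ "Pow n"]) (auto simp: Fpow_le_def Fpow_def)

lemma empty_in_Fpow_le: "{} \<in> Fpow_le n d"
  by (simp add: Fpow_le_def Fpow_def)

lemma Fpow_le_not_empty [simp]: "Fpow_le n d \<noteq> {}"
  using empty_in_Fpow_le by blast

lemma Fpow_le_empty: "Fpow_le {} d = {{}}"
  by (auto simp: Fpow_le_def Fpow_def)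

lemma Fpow_le_0: "Fpow_le n 0 = {{}}"
  by (auto simp: Fpow_le_def Fpow_def)

text \<open>A subset \<open>a\<close> meeting \<open>m\<close> splits into \<open>b = a - m\<close>
  and a nonempty \<open>c = a \<inter> m\<close>. Since \<open>c\<close> uses up at least one
  element, \<open>b\<close> has size at most \<open>d\<close>, which is where the degree drops by
  one.\<close>

lemma Fpow_le_Suc_Un:
  assumes "finite n" "finite m" "n \<inter> m = {}"
  shows "Fpow_le (n \<union> m) (Suc d) = Fpow_le n (Suc d) \<union>
    (\<Union>b\<in>Fpow_le n d. (\<union>) b ` {c. c \<subseteq> m \<and> c \<noteq> {} \<and> card b + card c \<le> Suc d})"
    (is "_ = _ \<union> ?U")
proof (intro equalityI subsetI)
  fix a assume a: "a \<in> Fpow_le (n \<union> m) (Suc d)"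
  show "a \<in> Fpow_le n (Suc d) \<union> ?U"
  proof (cases "a \<inter> m = {}")
    case True
    then show ?thesis using a by (auto simp: Fpow_le_def Fpow_def)
  next
    case False
    have fin: "finite a" and sub: "a \<subseteq> n \<union> m" and card: "card a \<le> Suc d"
      using a by (auto simp: Fpow_le_def Fpow_def)
    have split: "a = (a - m) \<union> (a \<inter> m)" by auto
    have "card ((a - m) \<union> (a \<inter> m)) = card (a - m) + card (a \<inter> m)"
      using fin by (intro card_Un_disjoint) auto
    then have sum: "card (a - m) + card (a \<inter> m) \<le> Suc d"
      using card split by simp
    have "card (a \<inter> m) > 0"
      using False fin by (simp add: card_gt_0_iff)
    then have "a - m \<in> Fpow_le n d"
      using sum sub fin by (auto simp: Fpow_le_def Fpow_def)
    moreover have "a \<in> (\<union>) (a - m) `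
        {c. c \<subseteq> m \<and> c \<noteq> {} \<and> card (a - m) + card c \<le> Suc d}"
      using split sum False by (intro image_eqI[of _ _ "a \<inter> m"]) auto
    ultimately show ?thesis by blast
  qed
next
  fix a assume "a \<in> Fpow_le n (Suc d) \<union> ?U"
  then consider "a \<in> Fpow_le n (Suc d)"
    | b c where "b \<in> Fpow_le n d" "c \<subseteq> m" "card b + card c \<le> Suc d" "a = b \<union> c"
    by blast
  then show "a \<in> Fpow_le (n \<union> m) (Suc d)"
  proof cases
    case 1
    then show ?thesis by (auto simp: Fpow_le_def Fpow_def)
  next
    case (2 b c)
    have "card a \<le> Suc d"
      using card_Un_le[of b c] 2 by simp
    then show ?thesis
      using 2 assms finite_subset[of c m] by (auto simp: Fpow_le_def Fpow_def)
  qed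
qed

section \<open>Subset sums are polynomial\<close>

lemma polynomial_le_sum1:
  fixes \<phi> :: "'a set \<Rightarrow> 'g::ab_semigroup_add"
  shows "polynomial_le d W (\<lambda>n. sum1 \<phi> (Fpow_le n d))"
\<comment> \<open>\<open>W\<close> and \<open>\<phi>\<close> vary because the difference lives on
  \<open>W - m\<close> and has its own coefficients.\<close>
proof (induction d arbitrary: W \<phi>)
  case 0
  then show ?case by (simp add: Fpow_le_0)
next
  case (Suc d)
  show ?case
    unfolding polynomial_le.simps
  proof (intro ballI impI)
    fix m assume m: "m \<in> Fpow W" "m \<noteq> {}"
    \<comment> \<open>\<open>C b\<close> lists the possible traces on \<open>m\<close> of the new
      sets whose part outside \<open>m\<close> is \<open>b\<close>; collecting their coefficients
      gives \<open>\<psi> b\<close>, the coefficient of the difference at \<open>b\<close>.\<close>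
    define C where "C b = {c. c \<subseteq> m \<and> c \<noteq> {} \<and> card b + card c \<le> Suc d}" for b :: "'a set"
    define \<psi> where "\<psi> b = sum1 (\<lambda>c. \<phi> (b \<union> c)) (C b)" for b
    have fm: "finite m" using m by (simp add: Fpow_def)
    have fC: "finite (C b)" for b
      by (rule finite_subset[of _ "Pow m"]) (auto simp: C_def fm)
    obtain x where x: "x \<in> m" using m by auto
    have "sum1 \<phi> (Fpow_le (n \<union> m) (Suc d)) =
        sum1 \<phi> (Fpow_le n (Suc d)) + sum1 \<psi> (Fpow_le n d)"
      if "n \<in> Fpow W" "n \<inter> m = {}" for n
    proof -
      have fn: "finite n" using that by (simp add: Fpow_def)
      have sub: "b \<subseteq> n" if "b \<in> Fpow_le n d" for b
        using that by (simp add: Fpow_le_def Fpow_def)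
      have nC: "C b \<noteq> {}" if "b \<in> Fpow_le n d" for b
      proof -
        \<comment> \<open>A single point of \<open>m\<close> always fits, as
          \<open>card b \<le> d\<close>; hence \<open>\<psi> b\<close> is a genuine sum.\<close>
        have "{x} \<in> C b" using that x by (simp add: C_def Fpow_le_def)
        then show ?thesis by auto
      qed
      have sum_b: "sum1 \<phi> ((\<union>) b ` C b) = \<psi> b" if "b \<in> Fpow_le n d" for b
        unfolding \<psi>_def
      proof (rule sum1_reindex)
        show "inj_on ((\<union>) b) (C b)"
          using sub[OF that] \<open>n \<inter> m = {}\<close> unfolding inj_on_def C_def by blast
      qed (simp_all add: fC nC that)
      let ?U = "\<Union>b\<in>Fpow_le n d. (\<union>) b ` C b"
      have "sum1 \<phi> (Fpow_le n (Suc d) \<union> ?U) = sum1 \<phi> (Fpow_le n (Suc d)) + sum1 \<phi> ?U"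
      proof (rule sum1_Un_disjoint)
        have "a \<notin> Fpow_le n (Suc d)" if "a \<in> ?U" for a
        proof -
          have "a \<inter> m \<noteq> {}" using that unfolding C_def by blast
          then show ?thesis using \<open>n \<inter> m = {}\<close> unfolding Fpow_le_def Fpow_def by blast
        qed
        then show "Fpow_le n (Suc d) \<inter> ?U = {}" by blast
        show "?U \<noteq> {}" using empty_in_Fpow_le[of n d] nC[of "{}"] by auto
      qed (simp_all add: fn fC)
      also have "sum1 \<phi> ?U = sum1 (\<lambda>b. sum1 \<phi> ((\<union>) b ` C b)) (Fpow_le n d)"
      proof (rule sum1_UN_disjoint)
        fix b b' assume b: "b \<in> Fpow_le n d" "b' \<in> Fpow_le n d" "b \<noteq> b'"
        \<comment> \<open>The index of a block can be read off from any member, so distinct blocks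
          are disjoint.\<close>
        have "a - m = b" if "a \<in> (\<union>) b ` C b" "b \<in> Fpow_le n d" for a b
        proof -
          obtain c where "a = b \<union> c" "c \<subseteq> m" using \<open>a \<in> (\<union>) b ` C b\<close> by (auto simp: C_def)
          then show ?thesis using sub[OF that(2)] \<open>n \<inter> m = {}\<close> by auto
        qed
        from this[OF _ b(1)] this[OF _ b(2)] b(3)
        show "(\<union>) b ` C b \<inter> (\<union>) b' ` C b' = {}"
          by (metis disjoint_iff)
      qed (simp_all add: fn fC nC)
      also have "\<dots> = sum1 \<psi> (Fpow_le n d)"
        by (rule sum1_cong) (simp_all add: fn sum_b)
      finally show ?thesis
        using Fpow_le_Suc_Un[OF fn fm that(2), of d] by (simp add: C_def)
    qed
    then show "\<exists>D. polynomial_le d (W - m) D \<and>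
        (\<forall>n\<in>Fpow W. n \<inter> m = {} \<longrightarrow> sum1 \<phi> (Fpow_le (n \<union> m) (Suc d)) =
          sum1 \<phi> (Fpow_le n (Suc d)) + D n)"
      by (intro exI[of _ "\<lambda>n. sum1 \<psi> (Fpow_le n d)"]) (simp add: Suc.IH)
  qed
qed

section \<open>Coefficients of a given polynomial mapping\<close>

lemma Fpow_le_Suc_insert:
  assumes "finite k" "x \<notin> k"
  shows "Fpow_le (insert x k) (Suc d) = Fpow_le k (Suc d) \<union> insert x ` Fpow_le k d"
proof -
  \<comment> \<open>For \<open>m = {x}\<close> there is one nonempty trace, and
    \<open>card b \<le> d\<close> leaves room for it.\<close>
  have "{c. c \<subseteq> {x} \<and> c \<noteq> {} \<and> card b + card c \<le> Suc d} = {{x}}" if "b \<in> Fpow_le k d" for b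
    using that by (auto simp: Fpow_le_def)
  then show ?thesis
    using Fpow_le_Suc_Un[of k "{x}" d] assms by auto
qed

lemma finite_linear_order_has_max:
  assumes "linear_order r" "finite A" "A \<noteq> {}"
  shows "\<exists>x\<in>A. \<forall>y\<in>A. (y, x) \<in> r"
  using assms(2,3)
proof (induction A rule: finite_ne_induct)
  case (singleton x)
  then show ?case
    using assms(1) by (auto simp: order_on_defs refl_on_def)
next
  case (insert x A)
  then obtain z where z: "z \<in> A" "\<forall>y\<in>A. (y, z) \<in> r" by auto
  have "refl r" "trans r" "total r"
    using assms(1) by (simp_all add: order_on_defs)
  then show ?case
    using z by (metis insert_iff refl_onD total_on_def transD UNIV_I)
qed

lemma polynomial_le_imp_sum1:
  fixes P :: "'a set \<Rightarrow> 'g::ab_semigroup_add"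
  assumes "polynomial_le d S P"
  shows "\<exists>\<phi>. \<forall>n\<in>Fpow S. P n = sum1 \<phi> (Fpow_le n d)"
  using assms
\<comment> \<open>The induction hypothesis is applied to a difference \<open>D\<close> on
  \<open>S - {x}\<close>.\<close>
proof (induction d arbitrary: S P)
  case 0
  then obtain c where "\<forall>n\<in>Fpow S. P n = c" by auto
  then show ?case
    by (intro exI[of _ "\<lambda>_. c"]) (simp add: Fpow_le_0 sum1_singleton)
next
  case (Suc d)
  have "\<forall>x\<in>S. \<exists>\<psi>. \<forall>n\<in>Fpow (S - {x}). P (insert x n) = P n + sum1 \<psi> (Fpow_le n d)"
  proof
    fix x assume "x \<in> S"
    then have "{x} \<in> Fpow S" by (simp add: Fpow_def)
    then obtain D where D: "polynomial_le d (S - {x}) D"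
        "\<forall>n\<in>Fpow S. n \<inter> {x} = {} \<longrightarrow> P (n \<union> {x}) = P n + D n"
      using Suc.prems by auto
    obtain \<psi> where "\<forall>n\<in>Fpow (S - {x}). D n = sum1 \<psi> (Fpow_le n d)"
      using Suc.IH[OF D(1)] by blast
    moreover have "P (insert x n) = P n + D n" if "n \<in> Fpow (S - {x})" for n
    proof -
      have "n \<in> Fpow S" "n \<inter> {x} = {}" using that by (auto simp: Fpow_def)
      then show ?thesis using D(2) by force
    qed
    ultimately have "\<forall>n\<in>Fpow (S - {x}). P (insert x n) = P n + sum1 \<psi> (Fpow_le n d)"
      by simp
    then show "\<exists>\<psi>. \<forall>n\<in>Fpow (S - {x}). P (insert x n) = P n + sum1 \<psi> (Fpow_le n d)"
      by (intro exI[of _ \<psi>])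
  qed
  \<comment> \<open>One coefficient map is chosen for each \<open>x\<close> at once; any choice will
    do, and no compatibility between different \<open>x\<close> is claimed.\<close>
  then obtain \<psi> where
    \<psi>: "P (insert x n) = P n + sum1 (\<psi> x) (Fpow_le n d)" if "x \<in> S" "n \<in> Fpow (S - {x})" for x n
    by (metis (no_types, lifting))
  \<comment> \<open>The type carries no order, so the well-ordering theorem supplies a linear
    one.\<close>
  obtain r :: "'a rel" where "well_order r"
    using well_order_on by blast
  then have r: "linear_order r" by (simp add: well_order_on_def)
  then have antisym: "antisym r" by (simp add: order_on_defs)
  define top where "top a = (THE x. x \<in> a \<and> (\<forall>y\<in>a. (y, x) \<in> r))" for a
  have top_eq: "top a = x" if "x \<in> a" "\<forall>y\<in>a. (y, x) \<in> r" for a x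
    unfolding top_def using that antisym by (intro the_equality) (auto dest: antisymD)
  \<comment> \<open>Each nonempty \<open>a\<close> is charged to the step at which its largest
    element is added; the empty set carries the starting value.\<close>
  define \<phi> where "\<phi> a = (if a = {} then P {} else \<psi> (top a) (a - {top a}))" for a
  have "P n = sum1 \<phi> (Fpow_le n (Suc d))" if "finite n" "n \<subseteq> S" for n
    using that
  proof (induction n rule: finite_psubset_induct)
    case (psubset n)
    show ?case
    proof (cases "n = {}")
      case True
      then show ?thesis
        by (simp add: Fpow_le_empty sum1_singleton \<phi>_def)
    next
      case False
      \<comment> \<open>Removing the maximum of \<open>n\<close> ensures that every subset
        containing \<open>x\<close> has top \<open>x\<close>, so the new terms of the sum are
        exactly those of \<open>\<psi> x\<close> over \<open>k\<close>.\<close>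
      obtain x where x: "x \<in> n" "\<forall>y\<in>n. (y, x) \<in> r"
        using finite_linear_order_has_max[OF r psubset.hyps False] by blast
      define k where "k = n - {x}"
      have k: "n = insert x k" "x \<notin> k" "finite k"
        using x psubset.hyps by (auto simp: k_def)
      have \<phi>_insert: "\<phi> (insert x a) = \<psi> x a" if "a \<in> Fpow_le k d" for a
      proof -
        have a: "a \<subseteq> k" using that by (simp add: Fpow_le_def Fpow_def)
        have "top (insert x a) = x"
          using a x k(1) by (intro top_eq) auto
        moreover have "insert x a - {x} = a"
          using a k(2) by auto
        ultimately show ?thesis by (simp add: \<phi>_def)
      qed
      have sub: "a \<subseteq> k" if "a \<in> Fpow_le k e" for a e
        using that by (simp add: Fpow_le_def Fpow_def)
      have "sum1 \<phi> (Fpow_le n (Suc d)) =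
          sum1 \<phi> (Fpow_le k (Suc d)) + sum1 \<phi> (insert x ` Fpow_le k d)"
        unfolding k(1) Fpow_le_Suc_insert[OF k(3,2)]
      proof (rule sum1_Un_disjoint)
        show "Fpow_le k (Suc d) \<inter> insert x ` Fpow_le k d = {}"
          using sub k(2) by blast
      qed (simp_all add: k(3))
      also have "sum1 \<phi> (insert x ` Fpow_le k d) = sum1 (\<lambda>a. \<phi> (insert x a)) (Fpow_le k d)"
      proof (rule sum1_reindex)
        show "inj_on (insert x) (Fpow_le k d)"
          \<comment> \<open>No member of \<open>Fpow_le k d\<close> contains \<open>x\<close>, so
            adding \<open>x\<close> loses no information.\<close>
          using sub k(2) by (intro inj_onI) (metis insert_ident subsetD)
      qed (simp_all add: k(3))
      also have "\<dots> = sum1 (\<psi> x) (Fpow_le k d)"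
        by (rule sum1_cong) (simp_all add: k(3) \<phi>_insert)
      also have "sum1 \<phi> (Fpow_le k (Suc d)) = P k"
        using psubset.IH[of k] psubset.prems k by (simp add: psubset_insert_iff)
      also have "P k + sum1 (\<psi> x) (Fpow_le k d) = P n"
        using \<psi>[of x k] psubset.prems k by (simp add: Fpow_def subset_Diff_insert)
      finally show ?thesis by simp
    qed
  qed
  then show ?case
    by (intro exI[of _ \<phi>]) (simp add: Fpow_def)
qed

theorem theorem8p3:
  fixes S :: "'a set" and d :: nat
  shows "(\<forall>\<phi> :: 'a set \<Rightarrow> 'g::ab_semigroup_add.
            polynomial_le d S (\<lambda>n. sum1 \<phi> (Fpow_le n d))) \<and>
         (\<forall>P :: 'a set \<Rightarrow> 'g.
            polynomial_le d S P \<longrightarrow>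
              (\<exists>\<phi> :: 'a set \<Rightarrow> 'g. \<forall>n\<in>Fpow S. P n = sum1 \<phi> (Fpow_le n d)))"
  using polynomial_le_sum1 polynomial_le_imp_sum1 by blast

end
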